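(* Let $S$ be a Polish space (with its Borel $\sigma$-algebra). Every image-finite nondeterministic kernel $\kappa: S\to w(S)$ is generating, i.e., the map $s\mapsto \mathfrak{F}(\kappa(s)) := \{U\in w(S)\mid \kappa(s)\subseteq U\}$ is t-measurable.
   Context: For a measurable space $S$ with $\sigma$-algebra $\Sigma(S)$, $\mathcal{S}(S)$ denotes the set of subprobability measures on $\Sigma(S)$, equipped with the $\sigma$-algebra $w(S)$ generated by the sets $\{\mu\in\mathcal{S}(S)\mid \mu(A)\bowtie q\}$ for $A\in\Sigma(S)$, $q\in[0,1]$, $\bowtie\in\{\le,<,\ge,>\}$. Thus elements of $w(S)$ are measurable sets of subprobabilities. The hit $\sigma$-algebra on $w(S)$ is the smallest $\sigma$-algebra containing all sets $\{D\in w(S)\mid D\cap C\neq\emptyset\}$, $C\in w(S)$. A nondeterministic kernel on $S$ is a map $\kappa:S\to w(S)$ that is measurable w.r.t. $\Sigma(S)$ and the hit $\sigma$-algebra; it is image-finite if $\kappa(s)$ is finite for all $s$. Let $\mathfrak{V}(S)$ be the set of upper closed subsets $V\subseteq w(S)$ (i.e. $A\in V$, $A\subseteq B\in w(S)$ imply $B\in V$). A map $P:S\to\mathfrak{V}(T)$ is t-measurable iff for every $H$ in the product $\sigma$-algebra $w(T)\otimes\mathcal{B}([0,1])$ on $\mathcal{S}(T)\times[0,1]$ one has $\{\langle s,q\rangle\mid H_q\in P(s)\}\in \Sigma(S)\otimes\mathcal{B}([0,1])$, where $H_q=\{\mu\mid\langle\mu,q\rangle\in H\}$. *)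

theory Defs
  imports "HOL-Probability.Probability"
begin

text \<open>
  The \<sigma>-algebra \<open>w(M)\<close> on the subprobability measures over \<open>M\<close> is the library's
  \<^term>\<open>subprob_algebra M\<close>. The library defines it by measurability of the evaluation maps;
  the next lemma gives the description by the generators \<open>{\<mu>. \<mu>(A) \<bowtie> q}\<close>.
\<close>

lemma sets_subprob_algebra_generators:
  fixes M :: "'a measure"
  shows "sets (subprob_algebra M) =
    sigma_sets (space (subprob_algebra M))
      {{\<mu> \<in> space (subprob_algebra M). R (measure \<mu> A) q} | R A q.
         R \<in> {(\<le>), (<), (\<ge>), (>)} \<and> A \<in> sets M \<and> q \<in> {0..1::real}}"
    (is "_ = sigma_sets ?\<Omega> ?G")
proof (rule antisym)
  have G: "?G \<subseteq> Pow ?\<Omega>" by auto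
  define N where "N = sigma ?\<Omega> ?G"
  have spN: "space N = ?\<Omega>" and stN: "sets N = sigma_sets ?\<Omega> ?G"
    unfolding N_def using G by (rule space_measure_of, rule sets_measure_of)
  have "id \<in> measurable N (subprob_algebra M)"
  proof (rule measurable_subprob_algebra)
    fix \<mu> assume "\<mu> \<in> space N"
    then show "subprob_space (id \<mu>)" "sets (id \<mu>) = sets M"
      unfolding spN by (auto simp: space_subprob_algebra)
  next
    fix A assume A: "A \<in> sets M"
    have m: "(\<lambda>\<mu>. measure \<mu> A) \<in> borel_measurable N"
    proof (rule borel_measurableI_le)
      fix y :: real
      have b: "0 \<le> measure \<mu> A \<and> measure \<mu> A \<le> 1" if "\<mu> \<in> ?\<Omega>" for \<mu>
        using that by (auto simp: space_subprob_algebra subprob_space.subprob_measure_le_1)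
      consider "y < 0" | "0 \<le> y" "y \<le> 1" | "1 < y" by linarith
      then show "{x \<in> space N. measure x A \<le> y} \<in> sets N"
      proof cases
        case 1
        then have "\<not> measure x A \<le> y" for x :: "'a measure"
          using measure_nonneg[of x A] by linarith
        then have "{x \<in> space N. measure x A \<le> y} = {}" by blast
        then show ?thesis by (simp only: sets.empty_sets)
      next
        case 2
        then have "{x \<in> space N. measure x A \<le> y} \<in> ?G"
          unfolding spN mem_Collect_eq using A
          by (intro exI[of _ "(\<le>)"] exI[of _ A] exI[of _ y]) simp
        then show ?thesis unfolding stN by (rule sigma_sets.Basic)
      next
        case 3
        then have "measure \<mu> A \<le> y" if "\<mu> \<in> space N" for \<mu>
          using b[of \<mu>] that unfolding spN by linarith
        then have "{x \<in> space N. measure x A \<le> y} = space N" by blast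
        then show ?thesis by (simp only: sets.top)
      qed
    qed
    have "(\<lambda>\<mu>. ennreal (measure \<mu> A)) \<in> borel_measurable N" using m by simp
    moreover have "ennreal (measure \<mu> A) = emeasure (id \<mu>) A" if "\<mu> \<in> space N" for \<mu>
    proof -
      have "subprob_space \<mu>" using that spN by (auto simp: space_subprob_algebra)
      then interpret subprob_space \<mu> .
      show ?thesis by (simp add: emeasure_eq_measure)
    qed
    ultimately show "(\<lambda>\<mu>. emeasure (id \<mu>) A) \<in> borel_measurable N"
      by (simp only: cong: measurable_cong)
  qed
  then have "id -` B \<inter> space N \<in> sets N" if "B \<in> sets (subprob_algebra M)" for B
    using that by (rule measurable_sets)
  moreover have "id -` B \<inter> space N = B" if "B \<in> sets (subprob_algebra M)" for B
    using sets.sets_into_space[OF that] spN by auto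
  ultimately show "sets (subprob_algebra M) \<subseteq> sigma_sets ?\<Omega> ?G"
    unfolding stN[symmetric] by (intro subsetI) (simp only:)
next
  have "?G \<subseteq> sets (subprob_algebra M)"
  proof
    fix X assume "X \<in> ?G"
    then obtain R A q where X: "X = {\<mu> \<in> ?\<Omega>. R (measure \<mu> A) q}"
      "R \<in> {(\<le>), (<), (\<ge>), (>)}" "A \<in> sets M" by (elim CollectE exE conjE)
    have m [measurable]: "(\<lambda>\<mu>. measure \<mu> A) \<in> borel_measurable (subprob_algebra M)"
      using X(3) by (rule measurable_measure_subprob_algebra)
    consider "R = (\<le>)" | "R = (<)" | "R = (\<ge>)" | "R = (>)" using X(2) by (elim insertE emptyE)
    then show "X \<in> sets (subprob_algebra M)"
      unfolding X(1) by cases (simp_all only:, measurable)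
  qed
  then show "sigma_sets ?\<Omega> ?G \<subseteq> sets (subprob_algebra M)"
    by (rule sets.sigma_sets_subset)
qed

text \<open>The points of this space are the measurable sets of \<open>W\<close>.\<close>

definition hit_algebra :: "'a measure \<Rightarrow> 'a set measure" where
  "hit_algebra W = sigma (sets W) {{D \<in> sets W. D \<inter> C \<noteq> {}} | C. C \<in> sets W}"

text \<open>Membership in \<^term>\<open>measurable M N\<close> includes that \<open>\<kappa>\<close> maps \<open>space M\<close> into \<open>w(M)\<close>.\<close>

definition nondet_kernel :: "'a measure \<Rightarrow> ('a \<Rightarrow> 'a measure set) \<Rightarrow> bool" where
  "nondet_kernel M \<kappa> \<longleftrightarrow> \<kappa> \<in> measurable M (hit_algebra (subprob_algebra M))"

definition image_finite :: "'a measure \<Rightarrow> ('a \<Rightarrow> 'a measure set) \<Rightarrow> bool" where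
  "image_finite M \<kappa> \<longleftrightarrow> (\<forall>s \<in> space M. finite (\<kappa> s))"

definition upper_closed_families :: "'a measure \<Rightarrow> 'a measure set set set" where
  "upper_closed_families M =
    {V. V \<subseteq> sets (subprob_algebra M) \<and>
        (\<forall>A \<in> V. \<forall>B \<in> sets (subprob_algebra M). A \<subseteq> B \<longrightarrow> B \<in> V)}"

definition t_measurable ::
  "'a measure \<Rightarrow> 'b measure \<Rightarrow> ('a \<Rightarrow> 'b measure set set) \<Rightarrow> bool" where
  "t_measurable M N P \<longleftrightarrow>
    P \<in> space M \<rightarrow> upper_closed_families N \<and>
    (\<forall>H \<in> sets (subprob_algebra N \<Otimes>\<^sub>M restrict_space borel {0..1::real}).
       {(s, q). s \<in> space M \<and> q \<in> {0..1} \<and> {\<mu>. (\<mu>, q) \<in> H} \<in> P s}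
         \<in> sets (M \<Otimes>\<^sub>M restrict_space borel {0..1::real}))"

definition principal_filter :: "'a measure \<Rightarrow> 'a measure set \<Rightarrow> 'a measure set set" where
  "principal_filter M D = {U \<in> sets (subprob_algebra M). D \<subseteq> U}"

definition generating :: "'a measure \<Rightarrow> ('a \<Rightarrow> 'a measure set) \<Rightarrow> bool" where
  "generating M \<kappa> \<longleftrightarrow> t_measurable M M (\<lambda>s. principal_filter M (\<kappa> s))"

end

theory Submission
  imports Defs
begin

text \<open>
  The set to be shown measurable is the complement of \<open>{(s, q). \<kappa> s \<inter> H'\<^sub>q \<noteq> {}}\<close>, where \<open>H'\<close>
  is the complement of \<open>H\<close>. The sets \<open>H'\<close> for which the latter is measurable contain the finite
  unions of rectangles and are closed under increasing unions, because hitting commutes with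
  unions. They are closed under decreasing intersections as well, because every \<open>\<kappa> s\<close> is
  finite: some point of \<open>\<kappa> s\<close> must lie in all members of a decreasing sequence of sets that all
  hit \<open>\<kappa> s\<close>. The monotone class theorem concludes.
\<close>

text \<open>Inductive generation makes rule induction available, with one case for the base family
  and one for each kind of monotone limit.\<close>

inductive_set monotone_class :: "'a set set \<Rightarrow> 'a set set" for A :: "'a set set" where
  basic: "X \<in> A \<Longrightarrow> X \<in> monotone_class A"
| incr: "(\<And>n::nat. F n \<in> monotone_class A) \<Longrightarrow> incseq F \<Longrightarrow> (\<Union>n. F n) \<in> monotone_class A"
| decr: "(\<And>n::nat. F n \<in> monotone_class A) \<Longrightarrow> decseq F \<Longrightarrow> (\<Inter>n. F n) \<in> monotone_class A"

context algebra
begin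

text \<open>Complementation swaps increasing unions with decreasing intersections, and the base
  algebra is closed under it.\<close>

lemma monotone_class_compl:
  assumes "X \<in> monotone_class M"
  shows "\<Omega> - X \<in> monotone_class M"
  using assms
proof induction
  case (basic X)
  then show ?case by (intro monotone_class.basic compl_sets)
next
  case (incr F)
  have "(\<Inter>n. \<Omega> - F n) \<in> monotone_class M"
    using incr by (intro monotone_class.decr) (auto simp: incseq_def decseq_def)
  then show ?case by simp
next
  case (decr F)
  have "(\<Union>n. \<Omega> - F n) \<in> monotone_class M"
    using decr by (intro monotone_class.incr) (auto simp: incseq_def decseq_def)
  then show ?case by simp
qed

lemma monotone_class_Un:
  assumes X: "X \<in> monotone_class M" and Y: "Y \<in> monotone_class M"
  shows "X \<union> Y \<in> monotone_class M"
proof -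
  \<comment> \<open>Union with a fixed set preserves both kinds of monotone limit.
    \<open>step\<close> is applied twice: first with a set of \<open>M\<close> held fixed and
    induction over \<open>X\<close>, then with \<open>X\<close> held fixed and induction over
    \<open>Y\<close>; the first result is the premise of the second.\<close>
  have step: "X \<union> Y \<in> monotone_class M"
    if Y: "Y \<in> monotone_class M" and X: "\<And>A. A \<in> M \<Longrightarrow> X \<union> A \<in> monotone_class M" for X Y
    using Y
  proof induction
    case (basic A)
    then show ?case by (rule X)
  next
    case (incr F)
    have "(\<Union>n. X \<union> F n) \<in> monotone_class M"
      using incr by (intro monotone_class.incr) (auto simp: incseq_def)
    then show ?case by simp
  next
    case (decr F)
    have "(\<Inter>n. X \<union> F n) \<in> monotone_class M"
      using decr by (intro monotone_class.decr) (auto simp: decseq_def)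
    then show ?case by simp
  qed
  have "X \<union> A \<in> monotone_class M" if A: "A \<in> M" for A
  proof -
    have "A \<union> X \<in> monotone_class M"
      using X by (rule step) (use A in \<open>auto intro: monotone_class.basic\<close>)
    then show ?thesis by (simp add: Un_commute)
  qed
  with Y show ?thesis by (rule step)
qed

text \<open>A countable union is the increasing union of its finite partial unions, so closure under
  complements and binary unions suffices.\<close>

theorem sigma_sets_subset_monotone_class: "sigma_sets \<Omega> M \<subseteq> monotone_class M"
proof
  fix X assume "X \<in> sigma_sets \<Omega> M"
  then show "X \<in> monotone_class M"
  proof induction
    case (Basic X)
    then show ?case by (rule monotone_class.basic)
  next
    case Empty
    then show ?case by (intro monotone_class.basic empty_sets)
  next
    case (Compl X)
    from Compl(2) show ?case by (rule monotone_class_compl)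
  next
    case (Union F)
    have "(\<Union>i\<le>n. F i) \<in> monotone_class M" for n
      using Union(2) by (induction n) (auto simp: atMost_Suc intro: monotone_class_Un)
    then have "(\<Union>n. \<Union>i\<le>n. F i) \<in> monotone_class M"
      by (intro monotone_class.incr) (auto simp: incseq_def intro: order_trans)
    moreover have "(\<Union>n. \<Union>i\<le>n. F i) = (\<Union>n. F n)" by auto
    ultimately show ?case by simp
  qed
qed

end

text \<open>The semiring structure gives access to \<open>generated_ring\<close>, whose members are
  finite unions of rectangles.\<close>

lemma semiring_of_sets_rectangles:
  "semiring_of_sets (space M \<times> space N) {A \<times> B | A B. A \<in> sets M \<and> B \<in> sets N}"
    (is "semiring_of_sets _ ?R")
proof
  have R: "A \<times> B \<in> ?R" if "A \<in> sets M" "B \<in> sets N" for A B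
    using that by blast
  show "?R \<subseteq> Pow (space M \<times> space N)"
    by (auto dest: sets.sets_into_space)
  show "{} \<in> ?R"
    using R[of "{}" "{}"] by simp
  fix X Y assume "X \<in> ?R" "Y \<in> ?R"
  then obtain A B C D where X: "X = A \<times> B" "A \<in> sets M" "B \<in> sets N"
    and Y: "Y = C \<times> D" "C \<in> sets M" "D \<in> sets N" by blast
  have "X \<inter> Y = (A \<inter> C) \<times> (B \<inter> D)" unfolding X(1) Y(1) by (rule Times_Int_Times)
  with R[of "A \<inter> C" "B \<inter> D"] X Y show "X \<inter> Y \<in> ?R" by simp
  \<comment> \<open>A point of \<open>X\<close> avoids \<open>Y\<close> either by its first
    coordinate lying outside \<open>C\<close>, or by its first lying in \<open>C\<close> and its
    second outside \<open>D\<close>.\<close>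
  let ?\<C> = "{(A - C) \<times> B, (A \<inter> C) \<times> (B - D)}"
  have "?\<C> \<subseteq> ?R"
    unfolding insert_subset using X Y by (intro conjI R empty_subsetI) auto
  moreover have "disjoint ?\<C>" by (auto simp: disjoint_def)
  moreover have "X - Y = \<Union> ?\<C>" unfolding X(1) Y(1) by auto
  ultimately show "\<exists>\<C>\<subseteq>?R. finite \<C> \<and> disjoint \<C> \<and> X - Y = \<Union> \<C>"
    by (intro exI[of _ ?\<C>] conjI) simp_all
qed

text \<open>If each point of \<open>F\<close> dropped out at some stage, it would stay out; at the
  largest of these finitely many stages no point of \<open>F\<close> would be left.\<close>

lemma finite_hits_decseq:
  fixes A :: "nat \<Rightarrow> 'a set"
  assumes "finite F" "decseq A" and hit: "\<And>n. F \<inter> A n \<noteq> {}"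
  shows "F \<inter> (\<Inter>n. A n) \<noteq> {}"
proof
  assume "F \<inter> (\<Inter>n. A n) = {}"
  then have "\<forall>x\<in>F. \<exists>n. x \<notin> A n" by blast
  then obtain k where k: "x \<notin> A (k x)" if "x \<in> F" for x by metis
  obtain x where x: "x \<in> F" "x \<in> A (Max (k ` F))" using hit by blast
  have "k x \<le> Max (k ` F)" using x \<open>finite F\<close> by simp
  then show False using decseqD[OF \<open>decseq A\<close>] k x by blast
qed

lemma finite_hit_measurable:
  assumes finite: "\<And>s. s \<in> space M \<Longrightarrow> finite (\<kappa> s)"
    and hit: "\<And>C. C \<in> sets W \<Longrightarrow> {s \<in> space M. \<kappa> s \<inter> C \<noteq> {}} \<in> sets M"
    and H: "H \<in> sets (W \<Otimes>\<^sub>M Q)"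
  shows "{(s, q) \<in> space M \<times> space Q. \<exists>\<mu>\<in>\<kappa> s. (\<mu>, q) \<in> H} \<in> sets (M \<Otimes>\<^sub>M Q)"
proof -
  define R where "R = {A \<times> B | A B. A \<in> sets W \<and> B \<in> sets Q}"
  interpret semiring_of_sets "space W \<times> space Q" R
    unfolding R_def by (rule semiring_of_sets_rectangles)
  interpret G: ring_of_sets "space W \<times> space Q" generated_ring
    by (rule generating_ring)
  have R: "R \<subseteq> generated_ring" by (auto intro: generated_ringI_Basic)
  \<comment> \<open>A ring of sets containing the whole space is an algebra, and the whole space is
    itself a rectangle.\<close>
  interpret G: algebra "space W \<times> space Q" generated_ring
    by unfold_locales (use R in \<open>auto simp: R_def\<close>)
  define hits where "hits H = {(s, q) \<in> space M \<times> space Q. \<exists>\<mu>\<in>\<kappa> s. (\<mu>, q) \<in> H}" for H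
  have "H \<in> sigma_sets (space W \<times> space Q) R"
    using H by (simp add: sets_pair_measure R_def)
  then have "H \<in> sigma_sets (space W \<times> space Q) generated_ring"
    using sigma_sets_subseteq[OF R] by blast
  then have "H \<in> monotone_class generated_ring"
    using G.sigma_sets_subset_monotone_class by blast
  then have "hits H \<in> sets (M \<Otimes>\<^sub>M Q)"
  proof induction
    case (basic H)
    then obtain C where C: "finite C" "C \<subseteq> R" "H = \<Union> C" by (rule generated_ringE)
    have "hits X \<in> sets (M \<Otimes>\<^sub>M Q)" if "X \<in> C" for X
    proof -
      from that C obtain A B where X: "X = A \<times> B" "A \<in> sets W" "B \<in> sets Q"
        unfolding R_def by blast
      have "hits X = {s \<in> space M. \<kappa> s \<inter> A \<noteq> {}} \<times> B"
        using sets.sets_into_space[OF X(3)] by (auto simp: hits_def X(1))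
      then show ?thesis using hit X by simp
    qed
    then have "(\<Union>X\<in>C. hits X) \<in> sets (M \<Otimes>\<^sub>M Q)" using C(1) by blast
    moreover have "hits H = (\<Union>X\<in>C. hits X)" by (auto simp: hits_def C(3))
    ultimately show ?case by simp
  next
    case (incr F)
    have "hits (\<Union>n. F n) = (\<Union>n. hits (F n))" by (auto simp: hits_def)
    then show ?case using incr by auto
  next
    case (decr F)
    \<comment> \<open>The witness for \<open>F n\<close> may vary with \<open>n\<close>; finiteness
      of \<open>\<kappa> s\<close>, applied to the decreasing sections at \<open>q\<close>, yields
      one witness for all \<open>n\<close>.\<close>
    have "(s, q) \<in> hits (\<Inter>n. F n)" if sq: "\<And>n. (s, q) \<in> hits (F n)" for s q
    proof -
      have "\<kappa> s \<inter> (\<Inter>n. {\<mu>. (\<mu>, q) \<in> F n}) \<noteq> {}"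
      proof (rule finite_hits_decseq)
        show "finite (\<kappa> s)" using finite sq by (auto simp: hits_def)
        show "decseq (\<lambda>n. {\<mu>. (\<mu>, q) \<in> F n})" using \<open>decseq F\<close> by (auto simp: decseq_def)
        show "\<kappa> s \<inter> {\<mu>. (\<mu>, q) \<in> F n} \<noteq> {}" for n using sq[of n] by (auto simp: hits_def)
      qed
      then show ?thesis using sq by (auto simp: hits_def)
    qed
    then have "hits (\<Inter>n. F n) = (\<Inter>n. hits (F n))" by (auto simp: hits_def)
    then show ?case using decr by auto
  qed
  then show ?thesis by (simp add: hits_def)
qed

lemma hit_algebra_generators:
  "{{D \<in> sets W. D \<inter> C \<noteq> {}} | C. C \<in> sets W} \<subseteq> Pow (sets W)"
  by blast

lemma nondet_kernel_sets:
  assumes "nondet_kernel M \<kappa>" "s \<in> space M"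
  shows "\<kappa> s \<in> sets (subprob_algebra M)"
  using measurable_space[OF assms[unfolded nondet_kernel_def]]
  unfolding hit_algebra_def space_measure_of[OF hit_algebra_generators] .

lemma nondet_kernel_hit:
  assumes \<kappa>: "nondet_kernel M \<kappa>" and C: "C \<in> sets (subprob_algebra M)"
  shows "{s \<in> space M. \<kappa> s \<inter> C \<noteq> {}} \<in> sets M"
proof -
  let ?hit = "{D \<in> sets (subprob_algebra M). D \<inter> C \<noteq> {}}"
  have "?hit \<in> sets (hit_algebra (subprob_algebra M))"
    unfolding hit_algebra_def sets_measure_of[OF hit_algebra_generators]
    by (rule sigma_sets.Basic) (use C in blast)
  then have "\<kappa> -` ?hit \<inter> space M \<in> sets M"
    by (rule measurable_sets[OF \<kappa>[unfolded nondet_kernel_def]])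
  moreover have "\<kappa> -` ?hit \<inter> space M = {s \<in> space M. \<kappa> s \<inter> C \<noteq> {}}"
    using nondet_kernel_sets[OF \<kappa>] by auto
  ultimately show ?thesis by simp
qed

lemma image_finite_imp_generating:
  assumes \<kappa>: "nondet_kernel M \<kappa>" and fin: "image_finite M \<kappa>"
  shows "generating M \<kappa>"
  unfolding generating_def t_measurable_def
proof (intro conjI ballI)
  show "(\<lambda>s. principal_filter M (\<kappa> s)) \<in> space M \<rightarrow> upper_closed_families M"
    by (auto simp: principal_filter_def upper_closed_families_def)
next
  let ?W = "subprob_algebra M" and ?Q = "restrict_space borel {0..1::real}"
  fix H assume H: "H \<in> sets (?W \<Otimes>\<^sub>M ?Q)"
  let ?H' = "space (?W \<Otimes>\<^sub>M ?Q) - H"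
  let ?hits = "{(s, q) \<in> space M \<times> space ?Q. \<exists>\<mu>\<in>\<kappa> s. (\<mu>, q) \<in> ?H'}"
  have "?hits \<in> sets (M \<Otimes>\<^sub>M ?Q)"
    using fin nondet_kernel_hit[OF \<kappa>] sets.compl_sets[OF H]
    by (intro finite_hit_measurable[where W = ?W]) (auto simp: image_finite_def)
  then have "space (M \<Otimes>\<^sub>M ?Q) - ?hits \<in> sets (M \<Otimes>\<^sub>M ?Q)" by (rule sets.compl_sets)
  moreover have "{(s, q). s \<in> space M \<and> q \<in> {0..1} \<and> {\<mu>. (\<mu>, q) \<in> H} \<in> principal_filter M (\<kappa> s)}
      = space (M \<Otimes>\<^sub>M ?Q) - ?hits"
  proof -
    \<comment> \<open>Sections of \<open>H\<close> are measurable, so membership in the filter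
      reduces to inclusion. As \<open>\<kappa> s\<close> lies in \<open>space ?W\<close>, this
      inclusion fails exactly when \<open>\<kappa> s\<close> hits the section of
      \<open>?H'\<close>.\<close>
    have "{\<mu>. (\<mu>, q) \<in> H} \<in> sets ?W" for q
      using sets_Pair2[OF H, of q] by (simp add: vimage_def)
    moreover have "\<mu> \<in> space ?W" if "s \<in> space M" "\<mu> \<in> \<kappa> s" for s \<mu>
      using nondet_kernel_sets[OF \<kappa> that(1)] that(2) sets.sets_into_space by blast
    ultimately show ?thesis
      by (auto simp: principal_filter_def space_pair_measure space_restrict_space)
  qed
  ultimately show "{(s, q). s \<in> space M \<and> q \<in> {0..1} \<and>
      {\<mu>. (\<mu>, q) \<in> H} \<in> principal_filter M (\<kappa> s)} \<in> sets (M \<Otimes>\<^sub>M ?Q)"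
    by simp
qed

theorem theorem4p15:
  fixes \<kappa> :: "'a::polish_space \<Rightarrow> 'a measure set"
  assumes "nondet_kernel borel \<kappa>"
    and "image_finite borel \<kappa>"
  shows "generating borel \<kappa>"
  using assms by (rule image_finite_imp_generating)

end
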